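(* Let $k\in\mathbb{N}$, $0<\tau\le 1$, $0<\mu\le 1$, $0\le\tau-\mu<1$, $0\le\delta<1$, $0\le\gamma<1$ and $\tau-\mu+\gamma<1$. Let $f(z)=z-\sum_{\nu=k+1}^{\infty}a_\nu z^\nu$ ($a_\nu\ge 0$) and $\psi(z)=z-\sum_{\nu=k+1}^{\infty}\lambda_\nu z^\nu$ ($\lambda_\nu\ge 0$) both be in the class $\mathcal{P}_{\tau,\mu}(k,\delta,\gamma)$. Then the modified Hadamard product $$\Omega(z):=(f*\psi)(z)=z-\sum_{\nu=k+1}^{\infty}a_\nu\lambda_\nu z^\nu$$ is in the class $\mathcal{P}_{\tau,\mu}(k,\delta,\xi)$ for every $\xi$ with $0\le\xi<1$, $\tau-\mu+\xi<1$ and $$\xi\le 1-\frac{(1-\gamma)^2(\mu+1)_k}{(1+\delta k)(\tau+1)_k}.$$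
   Context: $\mathbb{U}=\{z\in\mathbb{C}:|z|<1\}$, $\mathbb{N}=\{1,2,3,\dots\}$. For $k\in\mathbb{N}$, $\mathcal{P}(k)$ is the class of functions that are analytic and univalent in $\mathbb{U}$ and of the form $f(z)=z-\sum_{\nu=k+1}^{\infty}a_\nu z^\nu$ with all $a_\nu\ge 0$. Srivastava-Owa fractional derivative: for $0\le\varsigma<1$, $\mathfrak{D}_z^{\varsigma}g(z)=\frac{1}{\Gamma(1-\varsigma)}\frac{d}{dz}\int_0^z g(\zeta)(z-\zeta)^{-\varsigma}\,d\zeta$, where the multiplicity of $(z-\zeta)^{-\varsigma}$ is removed by requiring $\log(z-\zeta)$ to be real when $z-\zeta>0$. Tremblay operator: for $0<\tau\le 1$, $0<\mu\le 1$, $0\le\tau-\mu<1$, $\mathfrak{T}^{\tau,\mu}f(z)=\frac{\Gamma(\mu)}{\Gamma(\tau)}z^{1-\mu}\,\mathfrak{D}_z^{\tau-\mu}\big[z^{\tau-1}f(z)\big]$ for $z\in\mathbb{U}$. (Powers of $z$ and $\zeta$ are taken with the principal branch and the integral along the segment from $0$ to $z$; the resulting function is understood as extended analytically to all of $\mathbb{U}$, including $z=0$ and the negative real axis.) Class $\mathcal{P}_{\tau,\mu}(k,\delta,\gamma)$ (with $0<\tau\le1$, $0<\mu\le1$, $0\le\tau-\mu<1$, $0\le\delta<1$, $0\le\gamma<1$, $\tau-\mu+\gamma<1$): the set of $f\in\mathcal{P}(k)$ such that for all $z\in\mathbb{U}$ $$\Re\left(\frac{\Gamma(\mu+1)\Gamma(\tau)}{\Gamma(\tau+1)\Gamma(\mu)}z^{-1}\left[(1-\delta)\mathfrak{T}^{\tau,\mu}f(z)+\delta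 z\big(\mathfrak{T}^{\tau,\mu}f\big)'(z)\right]\right)>\gamma,$$ the value at $z=0$ being understood by removing the singularity. $\mathcal{P}_{\tau,\mu}(k,\delta,\xi)$ is the same class with $\gamma$ replaced by $\xi$. Pochhammer symbol: $(\lambda)_0=1$ and $(\lambda)_k=\lambda(\lambda+1)\cdots(\lambda+k-1)$ for $k\in\mathbb{N}$. *)

theory Defs
  imports "HOL-Complex_Analysis.Complex_Analysis"
begin

text \<open>Functions on the unit disc are total functions \<open>complex \<Rightarrow> complex\<close>;
  membership in the classes below depends only on the values in \<open>ball 0 1\<close>.\<close>

text \<open>The series \<open>\<Sum>\<^sub>\<nu>\<^sub>\<ge>\<^sub>k\<^sub>+\<^sub>1 a\<^sub>\<nu> z\<^sup>\<nu>\<close> is indexed by \<open>\<nu> = n + k + 1\<close>.\<close>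

definition neg_series :: "nat \<Rightarrow> (nat \<Rightarrow> real) \<Rightarrow> complex \<Rightarrow> complex" where
  "neg_series k a z = z - (\<Sum>n. of_real (a (n + k + 1)) * z ^ (n + k + 1))"

definition has_neg_series :: "(complex \<Rightarrow> complex) \<Rightarrow> nat \<Rightarrow> (nat \<Rightarrow> real) \<Rightarrow> bool" where
  "has_neg_series f k a \<longleftrightarrow>
     (\<forall>\<nu>\<ge>k+1. a \<nu> \<ge> 0) \<and>
     (\<forall>z\<in>ball 0 1. summable (\<lambda>n. of_real (a (n + k + 1)) * z ^ (n + k + 1)) \<and>
                   f z = neg_series k a z)"

definition class_P :: "nat \<Rightarrow> (complex \<Rightarrow> complex) set" where
  "class_P k = {f. f holomorphic_on ball 0 1 \<and> inj_on f (ball 0 1) \<and>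
                   (\<exists>a. has_neg_series f k a)}"

definition frac_deriv :: "real \<Rightarrow> (complex \<Rightarrow> complex) \<Rightarrow> complex \<Rightarrow> complex" where
  "frac_deriv s g z = 1 / of_real (Gamma (1 - s)) *
     deriv (\<lambda>w. contour_integral (linepath 0 w) (\<lambda>\<zeta>. g \<zeta> * (w - \<zeta>) powr of_real (- s))) z"

text \<open>The formula for the Tremblay operator with principal powers. It is meaningful off the
  branch cut \<open>\<real>\<^sub>\<le>\<^sub>0\<close> only.\<close>

definition tremblay_formula ::
    "real \<Rightarrow> real \<Rightarrow> (complex \<Rightarrow> complex) \<Rightarrow> complex \<Rightarrow> complex" where
  "tremblay_formula \<tau> \<mu> f z =
     of_real (Gamma \<mu> / Gamma \<tau>) * z powr of_real (1 - \<mu>) *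
     frac_deriv (\<tau> - \<mu>) (\<lambda>\<zeta>. \<zeta> powr of_real (\<tau> - 1) * f \<zeta>) z"

definition tremblay_extension ::
    "real \<Rightarrow> real \<Rightarrow> (complex \<Rightarrow> complex) \<Rightarrow> (complex \<Rightarrow> complex) \<Rightarrow> bool" where
  "tremblay_extension \<tau> \<mu> f F \<longleftrightarrow>
     F holomorphic_on ball 0 1 \<and>
     (\<forall>z \<in> ball 0 1 - \<real>\<^sub>\<le>\<^sub>0. F z = tremblay_formula \<tau> \<mu> f z)"

text \<open>The choice is unambiguous on the disc, see \<open>tremblay_eqI\<close> below.\<close>

definition tremblay ::
    "real \<Rightarrow> real \<Rightarrow> (complex \<Rightarrow> complex) \<Rightarrow> complex \<Rightarrow> complex" where
  "tremblay \<tau> \<mu> f = (SOME F. tremblay_extension \<tau> \<mu> f F)"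

lemma tremblay_extension_unique:
  assumes "tremblay_extension \<tau> \<mu> f F" "tremblay_extension \<tau> \<mu> f G" "z \<in> ball 0 1"
  shows "F z = G z"
proof (rule analytic_continuation_open[where f = F and g = G and s = "ball 0 1 - \<real>\<^sub>\<le>\<^sub>0" and s' = "ball 0 1"])
  show "ball 0 1 - \<real>\<^sub>\<le>\<^sub>0 \<noteq> ({} :: complex set)"
  proof -
    have "(1 / 2 :: complex) \<in> ball 0 1 - \<real>\<^sub>\<le>\<^sub>0"
      by (auto simp: complex_nonpos_Reals_iff)
    thus ?thesis by blast
  qed
qed (use assms in \<open>auto simp: tremblay_extension_def intro: open_Diff\<close>)

lemma tremblay_eqI:
  assumes "tremblay_extension \<tau> \<mu> f F" "z \<in> ball 0 1"
  shows "tremblay \<tau> \<mu> f z = F z"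
  using assms tremblay_extension_unique someI[of "tremblay_extension \<tau> \<mu> f" F]
  unfolding tremblay_def by blast

definition class_expr ::
    "real \<Rightarrow> real \<Rightarrow> real \<Rightarrow> (complex \<Rightarrow> complex) \<Rightarrow> complex \<Rightarrow> complex" where
  "class_expr \<tau> \<mu> \<delta> f z =
     of_real (Gamma (\<mu> + 1) * Gamma \<tau> / (Gamma (\<tau> + 1) * Gamma \<mu>)) * inverse z *
     (of_real (1 - \<delta>) * tremblay \<tau> \<mu> f z + of_real \<delta> * z * deriv (tremblay \<tau> \<mu> f) z)"

text \<open>\<open>remove_sings\<close> supplies the limit at \<open>z = 0\<close>; elsewhere in the disc
  \<open>class_expr\<close> is continuous and \<open>remove_sings\<close> leaves it unchanged.\<close>

definition class_PT ::
    "real \<Rightarrow> real \<Rightarrow> nat \<Rightarrow> real \<Rightarrow> real \<Rightarrow> (complex \<Rightarrow> complex) set" where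
  "class_PT \<tau> \<mu> k \<delta> \<gamma> =
     {f \<in> class_P k. \<forall>z\<in>ball 0 1. Re (remove_sings (class_expr \<tau> \<mu> \<delta> f) z) > \<gamma>}"

end

theory Submission
  imports Defs
begin

text \<open>
  A Beta integral shows that the Tremblay operator multiplies the coefficient of \<open>z\<^sup>n\<close> by
  \<open>(\<tau>)\<^sub>n / (\<mu>)\<^sub>n\<close>. Since all coefficients past the first are nonpositive, letting \<open>z\<close> tend
  to \<open>1\<close> along the reals turns membership in the class into the coefficient inequality
  \<open>\<Sum> w\<^sub>\<nu>\<^sub>-\<^sub>1 a\<^sub>\<nu> \<le> 1 - \<gamma>\<close> with the increasing weights
  \<open>w\<^sub>n = (1 + \<delta> n) (\<tau> + 1)\<^sub>n / (\<mu> + 1)\<^sub>n\<close>, and univalence into \<open>\<Sum> \<nu> a\<^sub>\<nu> \<le> 1\<close>.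
  The first inequality for \<open>f\<close> gives \<open>w\<^sub>\<nu>\<^sub>-\<^sub>1 a\<^sub>\<nu> \<le> 1 - \<gamma>\<close>, hence
  \<open>w\<^sub>\<nu>\<^sub>-\<^sub>1 a\<^sub>\<nu> \<lambda>\<^sub>\<nu> \<le> (1 - \<gamma>) / w\<^sub>k * (w\<^sub>\<nu>\<^sub>-\<^sub>1 \<lambda>\<^sub>\<nu>)\<close>, and the one for \<open>\<psi>\<close> bounds the sum by
  \<open>(1 - \<gamma>)\<^sup>2 / w\<^sub>k \<le> 1 - \<xi>\<close>; univalence of the product follows from \<open>a\<^sub>\<nu> \<le> 1\<close>.
\<close>

section \<open>Power series on the unit disc\<close>

lemma power_series_deriv:
  fixes c :: "nat \<Rightarrow> complex"
  assumes "\<And>z. norm z < 1 \<Longrightarrow> (\<lambda>n. c n * z ^ n) sums f z" and "norm z < 1"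
  shows "(f has_field_derivative deriv f z) (at z)"
    and "(\<lambda>n. of_nat n * c n * z ^ (n - 1)) sums deriv f z"
proof -
  have "((\<lambda>z. \<Sum>n. c n * z ^ n) has_field_derivative (\<Sum>n. diffs c n * z ^ n)) (at z)"
    by (rule termdiffs_strong'[where K = 1]) (use assms in \<open>auto simp: sums_iff\<close>)
  then have D: "(f has_field_derivative (\<Sum>n. diffs c n * z ^ n)) (at z)"
    by (rule DERIV_cong_ev[THEN iffD1, rotated -1])
       (use assms eventually_nhds_in_open[of "ball 0 1" z] in
         \<open>auto elim!: eventually_mono simp: sums_iff\<close>)
  have "summable (\<lambda>n. diffs c n * z ^ n)"
    by (rule termdiff_converges[where K = 1]) (use assms in \<open>auto simp: sums_iff\<close>)
  from diffs_equiv[OF this] D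
  show "(f has_field_derivative deriv f z) (at z)"
    and "(\<lambda>n. of_nat n * c n * z ^ (n - 1)) sums deriv f z"
    by (auto simp: DERIV_imp_deriv)
qed

lemma power_series_holomorphic_on_disc:
  fixes c :: "nat \<Rightarrow> complex"
  assumes "\<And>z. norm z < 1 \<Longrightarrow> (\<lambda>n. c n * z ^ n) sums f z"
  shows "f holomorphic_on ball 0 1"
  using power_series_deriv(1)[of c f] assms
  by (auto simp: holomorphic_on_open intro!: exI)

section \<open>Beta integrals and the Tremblay operator on power series\<close>

text \<open>Termwise integration, justified by dominated convergence. Since
  \<open>norm (t * w) \<le> norm w\<close> for \<open>t\<close> in \<open>{0..1}\<close>, every
  partial sum is bounded by the Beta density times \<open>M\<close>, the sum of the absolute values
  of the series at \<open>w\<close>. The density is unbounded at an endpoint whose exponent is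
  negative, so uniform convergence of the series for \<open>f\<close> alone would not settle the
  matter.\<close>

lemma Beta_transform_power_series:
  fixes b :: "nat \<Rightarrow> complex" and w :: complex
  assumes f: "\<And>z. norm z < 1 \<Longrightarrow> (\<lambda>n. b n * z ^ n) sums f z"
    and w: "norm w < 1" and p: "p > 0" and q: "q > 0"
  defines "g \<equiv> (\<lambda>t. of_real (t powr (p - 1) * (1 - t) powr (q - 1)) * f (of_real t * w))"
  shows "g integrable_on {0..1}"
    and "(\<lambda>n. b n * of_real (Beta (p + real n) q) * w ^ n) sums integral {0..1} g"
proof -
  define \<phi> where "\<phi> = (\<lambda>t::real. t powr (p - 1) * (1 - t) powr (q - 1))"
  define G where "G = (\<lambda>N t. \<Sum>n<N. (b n * w ^ n) *
      of_real (t powr (p + real n - 1) * (1 - t) powr (q - 1)))"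
  define M where "M = (\<Sum>n. norm (b n * w ^ n))"
  have summ: "summable (\<lambda>n. norm (b n * w ^ n))"
  proof -
    \<comment> \<open>Convergence at a radius strictly between \<open>norm w\<close> and 1 forces
      absolute convergence at \<open>w\<close>.\<close>
    obtain r where r: "norm w < r" "r < 1"
      using w dense by blast
    have "summable (\<lambda>n. b n * of_real r ^ n)"
      using f[of "of_real r"] r norm_ge_zero[of w] by (auto simp: sums_iff)
    then show ?thesis
      by (rule powser_insidea) (use r norm_ge_zero[of w] in auto)
  qed
  have G_int: "(G N has_integral (\<Sum>n<N. b n * of_real (Beta (p + real n) q) * w ^ n)) {0..1}" for N
  proof -
    have "(G N has_integral (\<Sum>n<N. b n * w ^ n * of_real (Beta (p + real n) q))) {0..1}"
      unfolding G_def
      by (intro has_integral_sum has_integral_mult_right has_integral_of_real has_integral_Beta_real)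
         (use p q in auto)
    then show ?thesis by (simp add: mult_ac)
  qed
  have G_eq: "G N t = of_real (\<phi> t) * (\<Sum>n<N. b n * (of_real t * w) ^ n)" if "t \<in> {0..1}" for N t
  proof -
    have "t powr (p + real n - 1) = t powr (p - 1) * t ^ n" for n
    \<comment> \<open>At \<open>t = 0\<close> both sides are 0, because \<open>0 powr x = 0\<close>
      for every \<open>x\<close>.\<close>
    proof (cases "t = 0")
      case False
      with that have "t > 0" by auto
      have "t powr (p + real n - 1) = t powr ((p - 1) + real n)"
        by (simp add: algebra_simps)
      also have "\<dots> = t powr (p - 1) * t ^ n"
        using \<open>t > 0\<close> by (simp only: powr_add powr_realpow)
      finally show ?thesis .
    qed auto
    then show ?thesis
      unfolding G_def \<phi>_def sum_distrib_left
      by (intro sum.cong) (auto simp: power_mult_distrib)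
  qed
  have h: "(\<lambda>t. \<phi> t * M) integrable_on {0..1}"
    unfolding \<phi>_def
    by (rule has_integral_integrable[OF has_integral_mult_left[OF has_integral_Beta_real[OF p q]]])
  have le: "norm (G N t) \<le> \<phi> t * M" if t: "t \<in> {0..1}" for N t
  proof -
    have "norm (\<Sum>n<N. b n * (of_real t * w) ^ n) \<le> (\<Sum>n<N. norm (b n * w ^ n))"
    proof (rule sum_norm_le)
      fix n
      have "(t * norm w) ^ n \<le> norm w ^ n"
        using t by (intro power_mono) (auto intro: mult_left_le_one_le)
      then have "norm (b n) * (t * norm w) ^ n \<le> norm (b n) * norm w ^ n"
        by (rule mult_left_mono) simp
      then show "norm (b n * (of_real t * w) ^ n) \<le> norm (b n * w ^ n)"
        using t by (simp add: norm_mult norm_power)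
    qed
    also have "\<dots> \<le> M"
      unfolding M_def by (rule sum_le_suminf[OF summ]) auto
    finally show ?thesis
      using t unfolding G_eq[OF t] by (simp add: norm_mult \<phi>_def mult_left_mono)
  qed
  have lim: "(\<lambda>N. G N t) \<longlonglongrightarrow> g t" if t: "t \<in> {0..1}" for t
  proof -
    have "norm (of_real t * w) < 1"
      using t w mult_left_le_one_le[of "norm w" t] by (auto simp: norm_mult)
    from f[OF this] have "(\<lambda>N. G N t) \<longlonglongrightarrow> of_real (\<phi> t) * f (of_real t * w)"
      unfolding G_eq[OF t] sums_def by (intro tendsto_intros)
    then show ?thesis by (simp add: g_def \<phi>_def)
  qed
  have Gi: "G N integrable_on {0..1}" for N
    using G_int by blast
  note * = dominated_convergence[of G "{0..1}", OF Gi h le lim]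
  show "g integrable_on {0..1}" using * by blast
  have "integral {0..1} (G N) = (\<Sum>n<N. b n * of_real (Beta (p + real n) q) * w ^ n)" for N
    using G_int by (rule integral_unique)
  with * show "(\<lambda>n. b n * of_real (Beta (p + real n) q) * w ^ n) sums integral {0..1} g"
    unfolding sums_def by simp
qed

text \<open>Substitute \<open>\<zeta> = t * w\<close>. The factors \<open>t\<close> and
  \<open>1 - t\<close> are nonnegative reals, so principal powers split off without a branch
  correction, even for \<open>w\<close> on the negative axis. The powers of \<open>w\<close> that
  come out, together with the derivative \<open>w\<close> of the path, combine to
  \<open>w powr (\<tau> - s)\<close>.\<close>

lemma contour_integral_fractional_kernel:
  fixes w :: complex
  assumes f: "\<And>z. norm z < 1 \<Longrightarrow> (\<lambda>n. b n * z ^ n) sums f z"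
    and w: "norm w < 1" "w \<noteq> 0" and "\<tau> > 0" "s < 1"
  shows "contour_integral (linepath 0 w)
           (\<lambda>\<zeta>. \<zeta> powr of_real (\<tau> - 1) * f \<zeta> * (w - \<zeta>) powr of_real (- s)) =
         w powr of_real (\<tau> - s) * (\<Sum>n. b n * of_real (Beta (\<tau> + real n) (1 - s)) * w ^ n)"
proof -
  define W where "W = w powr of_real (\<tau> - s)"
  define g where "g = (\<lambda>t. of_real (t powr (\<tau> - 1) * (1 - t) powr ((1 - s) - 1)) * f (of_real t * w))"
  note B = Beta_transform_power_series[OF f w(1) \<open>\<tau> > 0\<close>, of "1 - s", folded g_def]
  have I: "(g has_integral (\<Sum>n. b n * of_real (Beta (\<tau> + real n) (1 - s)) * w ^ n)) {0..1}"
    using B \<open>s < 1\<close> by (auto simp: sums_iff has_integral_integral)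
  have W: "W = w powr of_real (\<tau> - 1) * w powr of_real (- s) * w"
  proof -
    have "W = w powr (of_real (\<tau> - 1) + of_real (- s) + 1)"
      unfolding W_def by simp
    then show ?thesis using w(2) by (simp only: powr_add powr_to_1)
  qed
  have "((\<lambda>t. (linepath 0 w t) powr of_real (\<tau> - 1) * f (linepath 0 w t) *
            (w - linepath 0 w t) powr of_real (- s) * (w - 0)) has_integral
          W * (\<Sum>n. b n * of_real (Beta (\<tau> + real n) (1 - s)) * w ^ n)) {0..1}"
  proof (rule has_integral_eq[OF _ has_integral_mult_right[OF I]])
    fix t :: real assume t: "t \<in> {0..1}"
    have "(of_real t * w) powr of_real (\<tau> - 1) = of_real (t powr (\<tau> - 1)) * w powr of_real (\<tau> - 1)"
      using t by (subst powr_times_real_left) (auto simp flip: powr_of_real)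
    moreover have "(w - of_real t * w) powr of_real (- s) =
        of_real ((1 - t) powr (- s)) * w powr of_real (- s)"
    proof -
      have "w - of_real t * w = of_real (1 - t) * w" by (simp add: algebra_simps)
      then show ?thesis
        using t by (simp only:) (subst powr_times_real_left, auto simp flip: powr_of_real)
    qed
    moreover have "linepath 0 w t = of_real t * w"
      by (simp add: linepath_def scaleR_conv_of_real)
    ultimately show "W * g t = (linepath 0 w t) powr of_real (\<tau> - 1) * f (linepath 0 w t) *
            (w - linepath 0 w t) powr of_real (- s) * (w - 0)"
      by (simp add: W g_def)
  qed
  then show ?thesis
    unfolding W_def by (intro contour_integral_unique) (simp add: has_contour_integral_linepath)
qed

text \<open>With \<open>s = \<tau> - \<mu>\<close>, the Beta value has
  \<open>Gamma (\<mu> + n + 1)\<close> in its denominator. The factor \<open>\<mu> + n\<close>,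
  which arises from differentiating the power \<open>\<mu> + n\<close>, lowers this to
  \<open>Gamma (\<mu> + n)\<close>, and the remaining Gamma quotients are Pochhammer
  symbols.\<close>

lemma tremblay_multiplier_Beta:
  fixes \<tau> \<mu> :: real
  assumes "0 < \<tau>" "0 < \<mu>" "\<tau> - \<mu> < 1"
  shows "Gamma \<mu> / Gamma \<tau> / Gamma (1 - (\<tau> - \<mu>)) *
           ((\<mu> + real n) * Beta (\<tau> + real n) (1 - (\<tau> - \<mu>)))
         = pochhammer \<tau> n / pochhammer \<mu> n"
proof -
  have n: "\<tau> \<notin> \<int>\<^sub>\<le>\<^sub>0" "\<mu> \<notin> \<int>\<^sub>\<le>\<^sub>0"
    using assms by (auto elim!: nonpos_Ints_cases)
  have pos: "Gamma \<mu> > 0" "Gamma \<tau> > 0" "Gamma (1 - (\<tau> - \<mu>)) > 0"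
      "Gamma (\<mu> + real n) > 0" "Gamma (\<tau> + real n) > 0" "\<mu> + real n > 0"
    using assms by (auto intro!: Gamma_real_pos)
  have "Gamma (\<mu> + real n + 1) = (\<mu> + real n) * Gamma (\<mu> + real n)"
    using pos(6) by (intro Gamma_plus1) (auto elim!: nonpos_Ints_cases)
  moreover have "\<tau> + real n + (1 - (\<tau> - \<mu>)) = \<mu> + real n + 1" by simp
  ultimately have "(\<mu> + real n) * Beta (\<tau> + real n) (1 - (\<tau> - \<mu>)) =
      Gamma (\<tau> + real n) * Gamma (1 - (\<tau> - \<mu>)) / Gamma (\<mu> + real n)"
    using pos(6) by (simp only: Beta_def) simp
  then show ?thesis
    using pos(3) by (simp add: pochhammer_Gamma n)
qed

text \<open>The multiplied series defines a function holomorphic on the whole disc that agrees with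
  the principal-branch formula off the cut. Uniqueness of the extension then identifies it with
  \<open>tremblay\<close>.\<close>

proposition tremblay_power_series:
  fixes b :: "nat \<Rightarrow> complex"
  assumes f: "\<And>z. norm z < 1 \<Longrightarrow> (\<lambda>n. b n * z ^ n) sums f z"
    and \<tau>: "0 < \<tau>" and \<mu>: "0 < \<mu>" and "\<tau> - \<mu> < 1" and z: "norm z < 1"
  shows "(\<lambda>n. of_real (pochhammer \<tau> n / pochhammer \<mu> n) * b n * z ^ n) sums tremblay \<tau> \<mu> f z"
proof -
  define s where "s = \<tau> - \<mu>"
  define B where "B = (\<lambda>n. of_real (Beta (\<tau> + real n) (1 - s)) :: complex)"
  define G where "G = (\<lambda>w. \<Sum>n. b n * B n * w ^ n)"
  define K where "K = complex_of_real (Gamma \<mu> / Gamma \<tau>)"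
  define C where "C = complex_of_real (Gamma (1 - s))"
  \<comment> \<open>The contour integral equals \<open>w powr \<mu> * G w\<close>. Its derivative
    times \<open>w powr (1 - \<mu>)\<close> is \<open>\<mu> * G w + w * deriv G w\<close>, from
    which all fractional powers have disappeared.\<close>
  define F where "F = (\<lambda>w. K / C * (of_real \<mu> * G w + w * deriv G w))"
  have "s < 1" using assms by (simp add: s_def)
  have G: "(\<lambda>n. b n * B n * w ^ n) sums G w" if "norm w < 1" for w
    unfolding G_def B_def
    using Beta_transform_power_series(2)[OF f that \<tau>, of "1 - s"] \<open>s < 1\<close> by (simp add: sums_iff)
  note G' = power_series_deriv[of "\<lambda>n. b n * B n", OF G]
  have F_sums: "(\<lambda>n. of_real (pochhammer \<tau> n / pochhammer \<mu> n) * b n * w ^ n) sums F w"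
    if w: "norm w < 1" for w
  proof -
    have eq: "K / C * (of_real \<mu> * (b n * B n * w ^ n) + w * (of_nat n * (b n * B n) * w ^ (n - 1)))
        = of_real (pochhammer \<tau> n / pochhammer \<mu> n) * b n * w ^ n" for n
    proof -
      have "w * (of_nat n * (b n * B n) * w ^ (n - 1)) = of_nat n * (b n * B n * w ^ n)"
        by (cases n) auto
      then have "K / C * (of_real \<mu> * (b n * B n * w ^ n) + w * (of_nat n * (b n * B n) * w ^ (n - 1)))
        = (K / C * ((of_real \<mu> + of_nat n) * B n)) * b n * w ^ n"
        by (simp add: algebra_simps add_divide_distrib)
      also have "K / C * ((of_real \<mu> + of_nat n) * B n) = of_real (pochhammer \<tau> n / pochhammer \<mu> n)"
        using tremblay_multiplier_Beta[OF \<tau> \<mu> assms(4), of n, folded s_def, symmetric]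
        unfolding K_def B_def C_def by simp
      finally show ?thesis .
    qed
    show ?thesis
      unfolding F_def
      by (rule sums_cong[THEN iffD1, OF eq]) (intro sums_mult sums_add G G' w)
  qed
  have "tremblay_extension \<tau> \<mu> f F"
    unfolding tremblay_extension_def
  proof (intro conjI ballI)
    show "F holomorphic_on ball 0 1"
      using F_sums by (rule power_series_holomorphic_on_disc)
  next
    fix w :: complex assume "w \<in> ball 0 1 - \<real>\<^sub>\<le>\<^sub>0"
    then have w: "norm w < 1" "w \<notin> \<real>\<^sub>\<le>\<^sub>0" "w \<noteq> 0" by auto
    have "((\<lambda>w. w powr of_real \<mu> * G w) has_field_derivative
            (of_real \<mu> * w powr (of_real \<mu> - 1) * G w + deriv G w * w powr of_real \<mu>)) (at w)"
      by (intro DERIV_mult has_field_derivative_powr w G')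
    \<comment> \<open>The operator differentiates in the endpoint of the path, so the value of the
      integral is required on a neighbourhood of \<open>w\<close>.\<close>
    moreover have "eventually (\<lambda>v. v \<in> ball 0 1 - {0}) (nhds w)"
      using w by (intro eventually_nhds_in_open) auto
    then have "eventually (\<lambda>v. contour_integral (linepath 0 v)
        (\<lambda>\<zeta>. \<zeta> powr of_real (\<tau> - 1) * f \<zeta> * (v - \<zeta>) powr of_real (- s)) =
        v powr of_real \<mu> * G v) (nhds w)"
    proof eventually_elim
      case (elim v)
      then show ?case
        using contour_integral_fractional_kernel[OF f _ _ \<tau> \<open>s < 1\<close>, of v]
        by (simp add: G_def B_def s_def)
    qed
    ultimately have "frac_deriv s (\<lambda>\<zeta>. \<zeta> powr of_real (\<tau> - 1) * f \<zeta>) w =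
        1 / C * (of_real \<mu> * w powr (of_real \<mu> - 1) * G w + deriv G w * w powr of_real \<mu>)"
      unfolding frac_deriv_def C_def by (simp add: deriv_cong_ev DERIV_imp_deriv)
    moreover have "w powr of_real (1 - \<mu>) * w powr (of_real \<mu> - 1) = 1"
      using w by (simp flip: powr_add)
    moreover have "w powr of_real (1 - \<mu>) * w powr of_real \<mu> = w"
      using w by (simp flip: powr_add)
    ultimately show "F w = tremblay_formula \<tau> \<mu> f w"
      unfolding tremblay_formula_def F_def s_def[symmetric] K_def[symmetric]
      by (simp only: ring_distribs mult_1 mult_1_right) (simp add: field_simps)
  qed
  from tremblay_eqI[OF this, of z] z F_sums[OF z] show ?thesis by simp
qed

section \<open>The weights of the class condition\<close>

text \<open>The index is that of \<open>z ^ n\<close> in the class expression, hence belongs to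
  coefficient \<open>n + 1\<close> of \<open>f\<close>. The first factor is
  \<open>(1 - \<delta>) + \<delta> * (n + 1)\<close>; the quotient is the Tremblay multiplier at
  \<open>n + 1\<close> times the normalisation \<open>\<mu> / \<tau>\<close>.\<close>

definition class_weight :: "real \<Rightarrow> real \<Rightarrow> real \<Rightarrow> nat \<Rightarrow> real" where
  "class_weight \<tau> \<mu> \<delta> n = (1 + \<delta> * real n) * pochhammer (\<tau> + 1) n / pochhammer (\<mu> + 1) n"

lemma class_weight_0 [simp]: "class_weight \<tau> \<mu> \<delta> 0 = 1"
  by (simp add: class_weight_def)

lemma class_weight_pos:
  assumes "0 < \<tau>" "0 < \<mu>" "0 \<le> \<delta>"
  shows "0 < class_weight \<tau> \<mu> \<delta> n"
  using assms by (auto simp: class_weight_def add_pos_nonneg intro!: divide_pos_pos mult_pos_pos pochhammer_pos)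

text \<open>Each step multiplies the Pochhammer quotient by
  \<open>(\<tau> + 1 + n) / (\<mu> + 1 + n)\<close>, which is at least 1 because
  \<open>\<mu> \<le> \<tau>\<close>, while \<open>1 + \<delta> * n\<close> does not decrease
  either.\<close>

lemma class_weight_mono:
  assumes "0 < \<mu>" "\<mu> \<le> \<tau>" "0 \<le> \<delta>"
  shows "mono (class_weight \<tau> \<mu> \<delta>)"
proof (rule incseq_SucI)
  fix n
  have pos: "pochhammer (\<tau> + 1) n > 0" "pochhammer (\<mu> + 1) n > 0"
    using assms by (auto intro!: pochhammer_pos)
  have "1 \<le> (\<tau> + 1 + real n) / (\<mu> + 1 + real n)"
    using assms by (simp add: divide_simps)
  then have "pochhammer (\<tau> + 1) n / pochhammer (\<mu> + 1) n * 1 \<le>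
      pochhammer (\<tau> + 1) n / pochhammer (\<mu> + 1) n * ((\<tau> + 1 + real n) / (\<mu> + 1 + real n))"
    using pos by (intro mult_left_mono) auto
  then have "pochhammer (\<tau> + 1) n / pochhammer (\<mu> + 1) n \<le>
      pochhammer (\<tau> + 1) (Suc n) / pochhammer (\<mu> + 1) (Suc n)"
    by (simp add: pochhammer_Suc)
  then have "(1 + \<delta> * real n) * (pochhammer (\<tau> + 1) n / pochhammer (\<mu> + 1) n) \<le>
      (1 + \<delta> * real (Suc n)) * (pochhammer (\<tau> + 1) (Suc n) / pochhammer (\<mu> + 1) (Suc n))"
    using assms pos by (intro mult_mono) (auto simp: mult_left_mono intro!: divide_nonneg_nonneg)
  then show "class_weight \<tau> \<mu> \<delta> n \<le> class_weight \<tau> \<mu> \<delta> (Suc n)"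
    by (simp add: class_weight_def)
qed

text \<open>Off the origin the series is computed termwise. Its sum is continuous on the disc, so it
  is the limit that \<open>remove_sings\<close> returns, at 0 as well as elsewhere.\<close>

lemma class_expr_power_series:
  fixes b :: "nat \<Rightarrow> complex"
  assumes f: "\<And>z. norm z < 1 \<Longrightarrow> (\<lambda>n. b n * z ^ n) sums f z" and b0: "b 0 = 0"
    and \<tau>: "0 < \<tau>" and \<mu>: "0 < \<mu>" and "\<tau> - \<mu> < 1" and z: "norm z < 1"
  shows "(\<lambda>n. of_real (class_weight \<tau> \<mu> \<delta> n) * b (Suc n) * z ^ n) sums
           remove_sings (class_expr \<tau> \<mu> \<delta> f) z"
proof -
  define T where "T = tremblay \<tau> \<mu> f"
  define t where "t = (\<lambda>n. complex_of_real (pochhammer \<tau> n / pochhammer \<mu> n))"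
  define e where "e = (\<lambda>n. of_real (class_weight \<tau> \<mu> \<delta> n) * b (Suc n))"
  define H where "H = (\<lambda>v. \<Sum>n. e n * v ^ n)"
  have T: "(\<lambda>n. t n * b n * v ^ n) sums T v" if "norm v < 1" for v
    using tremblay_power_series[OF f \<tau> \<mu> assms(5) that] unfolding T_def t_def .
  note T' = power_series_deriv(2)[of "\<lambda>n. t n * b n", OF T]
  have "Gamma (\<mu> + 1) * Gamma \<tau> / (Gamma (\<tau> + 1) * Gamma \<mu>) = \<mu> / \<tau>"
  proof -
    have "Gamma (\<mu> + 1) = \<mu> * Gamma \<mu>" "Gamma (\<tau> + 1) = \<tau> * Gamma \<tau>"
      using \<tau> \<mu> by (auto intro!: Gamma_plus1 elim!: nonpos_Ints_cases)
    moreover have "Gamma \<mu> > 0" "Gamma \<tau> > 0"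
      using \<tau> \<mu> by (auto intro!: Gamma_real_pos)
    ultimately show ?thesis by simp
  qed
  then have class_expr: "class_expr \<tau> \<mu> \<delta> f v = of_real (\<mu> / \<tau>) * inverse v *
      (of_real (1 - \<delta>) * T v + of_real \<delta> * v * deriv T v)" for v
    unfolding class_expr_def T_def by simp
  have expr: "(\<lambda>n. e n * v ^ n) sums class_expr \<tau> \<mu> \<delta> f v" if v: "norm v < 1" "v \<noteq> 0" for v
  proof -
    have "(\<lambda>n. of_real (1 - \<delta>) * (t n * b n * v ^ n) +
        of_real \<delta> * v * (of_nat n * (t n * b n) * v ^ (n - 1))) sums
        (of_real (1 - \<delta>) * T v + of_real \<delta> * v * deriv T v)"
      by (intro sums_add sums_mult T T' v)
    \<comment> \<open>The term of index 0 vanishes by \<open>b 0 = 0\<close>; dropping it leaves a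
      factor \<open>v\<close> in each term to cancel against \<open>inverse v\<close>.\<close>
    then have "(\<lambda>n. of_real (1 - \<delta>) * (t (Suc n) * b (Suc n) * v ^ Suc n) +
        of_real \<delta> * v * (of_nat (Suc n) * (t (Suc n) * b (Suc n)) * v ^ (Suc n - 1))) sums
        (of_real (1 - \<delta>) * T v + of_real \<delta> * v * deriv T v)"
      by (subst sums_Suc_iff) (simp add: b0)
    then have *: "(\<lambda>n. of_real (\<mu> / \<tau>) * inverse v *
        (of_real (1 - \<delta>) * (t (Suc n) * b (Suc n) * v ^ Suc n) +
         of_real \<delta> * v * (of_nat (Suc n) * (t (Suc n) * b (Suc n)) * v ^ (Suc n - 1)))) sums
        class_expr \<tau> \<mu> \<delta> f v"
      unfolding class_expr by (rule sums_mult)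
    have "of_real (\<mu> / \<tau>) * inverse v *
        (of_real (1 - \<delta>) * (t (Suc n) * b (Suc n) * v ^ Suc n) +
         of_real \<delta> * v * (of_nat (Suc n) * (t (Suc n) * b (Suc n)) * v ^ (Suc n - 1)))
        = e n * v ^ n" for n
    proof -
      have "\<mu> / \<tau> * (pochhammer \<tau> (Suc n) / pochhammer \<mu> (Suc n)) =
          pochhammer (\<tau> + 1) n / pochhammer (\<mu> + 1) n"
        using \<tau> \<mu> by (simp add: pochhammer_rec)
      then have "class_weight \<tau> \<mu> \<delta> n =
          (1 + \<delta> * real n) * (\<mu> / \<tau> * (pochhammer \<tau> (Suc n) / pochhammer \<mu> (Suc n)))"
        by (simp add: class_weight_def)
      then have en: "e n = (1 + of_real \<delta> * of_nat n) * (of_real (\<mu> / \<tau>) * t (Suc n)) * b (Suc n)"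
        by (simp add: e_def t_def)
      show ?thesis unfolding en using v \<tau> by (simp add: field_simps)
    qed
    with * show ?thesis by simp
  qed
  have H: "(\<lambda>n. e n * v ^ n) sums H v" if "norm v < 1" for v
    unfolding H_def using expr[OF that] by (cases "v = 0") (auto simp: sums_iff)
  have "isCont H z"
    using power_series_deriv(1)[of e, OF H z] by (rule DERIV_isCont)
  then have "(H \<longlongrightarrow> H z) (at z)"
    by (simp add: isCont_def)
  \<comment> \<open>Excluding 0 in addition to \<open>z\<close> treats the origin and all other
    points alike.\<close>
  moreover have "eventually (\<lambda>v. v \<in> ball 0 1 - {z} \<and> v \<noteq> 0) (at z)"
    by (intro eventually_conj eventually_at_in_open eventually_neq_at_within) (use z in auto)
  then have "eventually (\<lambda>v. H v = class_expr \<tau> \<mu> \<delta> f v) (at z)"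
    by eventually_elim (auto intro!: sums_unique2[OF H expr])
  ultimately have "(class_expr \<tau> \<mu> \<delta> f \<longlongrightarrow> H z) (at z)"
    by (rule Lim_transform_eventually)
  then have "remove_sings (class_expr \<tau> \<mu> \<delta> f) z = H z"
    by (rule remove_sings_eqI)
  with H[OF z] show ?thesis by (simp add: e_def)
qed

section \<open>The coefficient criterion for the class\<close>

text \<open>Indexing from 0 makes the general power series lemmas applicable to the shifted series
  of \<open>has_neg_series\<close>.\<close>

definition neg_coeffs :: "nat \<Rightarrow> (nat \<Rightarrow> real) \<Rightarrow> nat \<Rightarrow> complex" where
  "neg_coeffs k a n = (if n = 1 then 1 else if n > k then - of_real (a n) else 0)"

lemma neg_coeffs_sums:
  assumes "has_neg_series f k a" "k \<ge> 1" "norm z < 1"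
  shows "(\<lambda>n. neg_coeffs k a n * z ^ n) sums f z"
proof -
  define h where "h = (\<lambda>n. (if n > k then of_real (a n) else 0) * z ^ n)"
  have "(\<lambda>n. of_real (a (n + k + 1)) * z ^ (n + k + 1)) sums (z - f z)"
    using assms by (simp add: has_neg_series_def neg_series_def summable_sums)
  then have "(\<lambda>n. h (n + (k + 1))) sums (z - f z)"
    by (simp add: h_def add.assoc)
  then have "h sums (z - f z)"
    by (subst (asm) sums_zero_iff_shift) (auto simp: h_def)
  from sums_diff[OF sums_single[of 1 "\<lambda>n. z ^ n"] this]
  have "(\<lambda>n. (if n = 1 then z ^ n else 0) - h n) sums f z" by simp
  moreover have "(if n = 1 then z ^ n else 0) - h n = neg_coeffs k a n * z ^ n" for n
    using assms(2) by (auto simp: h_def neg_coeffs_def)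
  ultimately show ?thesis by simp
qed

text \<open>Common to two expansions: \<open>W\<close> is \<open>class_weight\<close> for the class
  expression and \<open>n + 1\<close> for the derivative of \<open>f\<close>. Since
  \<open>W 0 = 1\<close>, subtracting from 1 cancels the constant term and leaves only nonnegative
  coefficients when \<open>a\<close> and \<open>W\<close> are nonnegative.\<close>

lemma neg_coeffs_weighted_sums:
  assumes "(\<lambda>n. of_real (W n) * neg_coeffs k a (Suc n) * z ^ n) sums R" "W 0 = 1" "k \<ge> 1"
  shows "(\<lambda>n. of_real (W (n + k) * a (n + k + 1)) * z ^ (n + k)) sums (1 - R)"
proof -
  define h where "h = (\<lambda>n. (if n = 0 then 1 else 0) - of_real (W n) * neg_coeffs k a (Suc n) * z ^ n)"
  have "h sums (1 - R)"
    using sums_diff[OF sums_single[of 0 "\<lambda>n. 1 :: complex"] assms(1)] by (simp add: h_def)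
  moreover have "\<forall>n<k. h n = 0"
    using assms(2,3) by (auto simp: h_def neg_coeffs_def)
  ultimately have "(\<lambda>n. h (n + k)) sums (1 - R)"
    by (simp add: sums_zero_iff_shift)
  moreover have "h (n + k) = of_real (W (n + k) * a (n + k + 1)) * z ^ (n + k)" for n
    using assms(3) by (simp add: h_def neg_coeffs_def)
  ultimately show ?thesis by simp
qed

text \<open>A finite partial sum is at most \<open>S \<le> C\<close> for each \<open>x < 1\<close>
  by nonnegativity, and being a polynomial in \<open>x\<close> it keeps the bound as
  \<open>x\<close> tends to 1 from the left. Bounded partial sums then give convergence.\<close>

lemma nonneg_series_le_of_power_sums_le:
  fixes p :: "nat \<Rightarrow> real"
  assumes nonneg: "\<And>n. p n \<ge> 0"
    and bound: "\<And>x. 0 < x \<Longrightarrow> x < 1 \<Longrightarrow> \<exists>S\<le>C. (\<lambda>n. p n * x ^ m n) sums S"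
  shows "summable p" "suminf p \<le> C"
proof -
  have le: "sum p {..<N} \<le> C" for N
  proof (rule tendsto_upperbound)
    have "((\<lambda>x. \<Sum>n<N. p n * x ^ m n) \<longlongrightarrow> (\<Sum>n<N. p n * 1 ^ m n)) (at_left (1::real))"
      by (intro tendsto_intros)
    then show "((\<lambda>x. \<Sum>n<N. p n * x ^ m n) \<longlongrightarrow> sum p {..<N}) (at_left (1::real))"
      by simp
    have "eventually (\<lambda>x. x \<in> {0<..<1}) (at_left (1::real))"
      by (rule eventually_at_leftI[of 0]) auto
    then show "eventually (\<lambda>x. (\<Sum>n<N. p n * x ^ m n) \<le> C) (at_left (1::real))"
    proof eventually_elim
      case (elim x)
      with bound obtain S where S: "S \<le> C" "(\<lambda>n. p n * x ^ m n) sums S" by auto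
      then have "(\<Sum>n<N. p n * x ^ m n) \<le> S"
        using elim nonneg by (auto simp: sums_iff intro!: sum_le_suminf)
      with S show ?case by simp
    qed
  qed simp
  from nonneg le show "summable p"
    by (intro summableI_nonneg_bounded)
  from this le show "suminf p \<le> C"
    by (intro suminf_le_const)
qed

text \<open>One direction restricts to real \<open>z\<close> tending to 1. In the other,
  \<open>norm (1 - R z) \<le> suminf p * norm z\<close>, where the factor \<open>norm z < 1\<close>
  makes the inequality strict even if the sum equals \<open>1 - \<gamma>\<close>.\<close>

lemma Re_mem_class_iff:
  assumes f: "has_neg_series f k a" and k: "k \<ge> 1"
    and \<tau>: "0 < \<tau>" and \<mu>: "0 < \<mu>" and "\<tau> - \<mu> < 1" and "0 \<le> \<delta>" and \<gamma>: "\<gamma> < 1"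
  defines "p \<equiv> (\<lambda>n. class_weight \<tau> \<mu> \<delta> (n + k) * a (n + k + 1))"
  shows "(\<forall>z\<in>ball 0 1. Re (remove_sings (class_expr \<tau> \<mu> \<delta> f) z) > \<gamma>) \<longleftrightarrow>
           summable p \<and> suminf p \<le> 1 - \<gamma>"
proof -
  define R where "R = remove_sings (class_expr \<tau> \<mu> \<delta> f)"
  have p: "p n \<ge> 0" for n
    using f class_weight_pos[OF \<tau> \<mu> \<open>0 \<le> \<delta>\<close>, of "n + k"] by (simp add: p_def has_neg_series_def)
  have sums: "(\<lambda>n. of_real (p n) * z ^ (n + k)) sums (1 - R z)" if "norm z < 1" for z
    unfolding p_def R_def
    by (rule neg_coeffs_weighted_sums[OF class_expr_power_series])
       (use neg_coeffs_sums[OF f k] assms that in \<open>auto simp: neg_coeffs_def\<close>)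
  have "summable p \<and> suminf p \<le> 1 - \<gamma>" if Re: "\<forall>z\<in>ball 0 1. Re (R z) > \<gamma>"
  proof -
    have "\<exists>S\<le>1 - \<gamma>. (\<lambda>n. p n * x ^ (n + k)) sums S" if x: "0 < x" "x < 1" for x :: real
      using sums_Re[OF sums[of "of_real x"]] Re[rule_format, of "of_real x"] x
      by (intro exI[of _ "1 - Re (R (of_real x))"]) (simp flip: of_real_power)
    from nonneg_series_le_of_power_sums_le[OF p this] show ?thesis by blast
  qed
  moreover have "Re (R z) > \<gamma>" if summ: "summable p" "suminf p \<le> 1 - \<gamma>" and z: "norm z < 1" for z
  proof -
    have le: "norm (of_real (p n) * z ^ (n + k)) \<le> p n * norm z" for n
    proof -
      \<comment> \<open>Here \<open>k \<ge> 1\<close> enters: every term contains at least one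
        factor \<open>norm z\<close>.\<close>
      have "norm z ^ (n + k) \<le> norm z ^ 1"
        using z k by (intro power_decreasing) auto
      then show ?thesis
        using p[of n] by (simp add: norm_mult norm_power mult_left_mono)
    qed
    have "norm (1 - R z) = norm (\<Sum>n. of_real (p n) * z ^ (n + k))"
      using sums[OF z] by (simp add: sums_iff)
    also have "\<dots> \<le> (\<Sum>n. p n * norm z)"
      by (rule norm_suminf_le[OF le summable_mult2[OF summ(1)]])
    also have "\<dots> = suminf p * norm z"
      using summ(1) by (simp add: suminf_mult2)
    also have "\<dots> \<le> (1 - \<gamma>) * norm z"
      using summ(2) by (rule mult_right_mono) simp
    also have "\<dots> < 1 - \<gamma>"
      using z \<gamma> by simp
    finally show ?thesis
      using complex_Re_le_cmod[of "1 - R z"] by simp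
  qed
  ultimately show ?thesis unfolding R_def by auto
qed

section \<open>Univalence and the coefficient sum\<close>

lemma norm_power_diff_le:
  fixes z w :: complex
  assumes "norm z \<le> r" "norm w \<le> r"
  shows "norm (z ^ Suc n - w ^ Suc n) \<le> real (Suc n) * r ^ n * norm (z - w)"
proof (induction n)
  case (Suc n)
  have "r \<ge> 0" using assms(1) norm_ge_zero order_trans by blast
  have "z ^ Suc (Suc n) - w ^ Suc (Suc n) = z * (z ^ Suc n - w ^ Suc n) + (z - w) * w ^ Suc n"
    by (simp add: algebra_simps)
  also have "norm \<dots> \<le> norm z * norm (z ^ Suc n - w ^ Suc n) + norm (z - w) * norm w ^ Suc n"
    by (metis norm_triangle_ineq norm_mult norm_power)
  also have "\<dots> \<le> r * (real (Suc n) * r ^ n * norm (z - w)) + norm (z - w) * r ^ Suc n"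
    using assms Suc.IH \<open>r \<ge> 0\<close> by (intro add_mono mult_mono power_mono) auto
  also have "\<dots> = real (Suc (Suc n)) * r ^ Suc n * norm (z - w)"
    by (simp add: algebra_simps)
  finally show ?case .
qed auto

text \<open>On the real axis \<open>f'\<close> is real, equals \<open>1\<close> at \<open>0\<close> and never vanishes, so it stays positive
  up to \<open>1\<close>.\<close>

lemma univalent_imp_coeff_sum_le_1:
  assumes f: "has_neg_series f k a" and k: "k \<ge> 1" and inj: "inj_on f (ball 0 1)"
  defines "q \<equiv> (\<lambda>n. real (n + k + 1) * a (n + k + 1))"
  shows "summable q" "suminf q \<le> 1"
proof -
  note ser = neg_coeffs_sums[OF f k]
  have hol: "f holomorphic_on ball 0 1"
    using ser by (rule power_series_holomorphic_on_disc)
  have sums: "(\<lambda>n. of_real (q n) * z ^ (n + k)) sums (1 - deriv f z)" if "norm z < 1" for z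
  proof -
    have "(\<lambda>n. of_nat (Suc n) * neg_coeffs k a (Suc n) * z ^ (Suc n - 1)) sums deriv f z"
      by (subst sums_Suc_iff) (use power_series_deriv(2)[OF ser that] in simp)
    then show ?thesis
      using neg_coeffs_weighted_sums[where W = "\<lambda>n. real (Suc n)"] k by (simp add: q_def)
  qed
  define D where "D = (\<lambda>x. Re (deriv f (of_real x)))"
  have D: "(\<lambda>n. q n * x ^ (n + k)) sums (1 - D x)" "deriv f (of_real x) = of_real (D x)"
    if "0 \<le> x" "x < 1" for x
  proof -
    have s: "(\<lambda>n. of_real (q n * x ^ (n + k))) sums (1 - deriv f (of_real x))"
      using sums[of "of_real x"] that by simp
    show "(\<lambda>n. q n * x ^ (n + k)) sums (1 - D x)"
      using sums_Re[OF s] by (simp add: D_def)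
    have "Im (deriv f (of_real x)) = 0"
      using sums_Im[OF s] sums_unique2[OF sums_zero] by fastforce
    then show "deriv f (of_real x) = of_real (D x)"
      by (simp add: D_def complex_eq_iff)
  qed
  have nz: "D x \<noteq> 0" if "0 \<le> x" "x < 1" for x
    using holomorphic_injective_imp_regular[OF hol open_ball inj, of "of_real x"] D(2)[of x] that
    by auto
  \<comment> \<open>Because \<open>k \<ge> 1\<close>, each term \<open>q n * 0 ^ (n + k)\<close> is
    0.\<close>
  have "D 0 = 1"
    using sums_unique2[OF D(1)[of 0] sums_zero[THEN sums_cong[THEN iffD1, rotated]]] k by simp
  have pos: "D x > 0" if x: "0 \<le> x" "x < 1" for x
  proof (rule ccontr)
    assume "\<not> D x > 0"
    have "continuous_on (ball 0 1) (deriv f)"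
      using holomorphic_deriv[OF hol open_ball] by (rule holomorphic_on_imp_continuous_on)
    then have "continuous_on {0..x} (\<lambda>y. deriv f (of_real y))"
      by (rule continuous_on_compose2) (use x in \<open>auto intro!: continuous_intros\<close>)
    then have "continuous_on {0..x} D"
      unfolding D_def by (intro continuous_intros)
    then obtain y where "0 \<le> y" "y \<le> x" "D y = 0"
      using IVT2'[of D x 0 0] \<open>\<not> D x > 0\<close> \<open>D 0 = 1\<close> x by auto
    with nz x show False by auto
  qed
  have q: "q n \<ge> 0" for n
    using f by (simp add: q_def has_neg_series_def)
  have "\<exists>S\<le>1. (\<lambda>n. q n * x ^ (n + k)) sums S" if "0 < x" "x < 1" for x
    using D(1)[of x] pos[of x] that by (intro exI[of _ "1 - D x"]) auto
  from nonneg_series_le_of_power_sums_le[OF q this] show "summable q" "suminf q \<le> 1" by auto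
qed

text \<open>If \<open>f z = f w\<close>, then \<open>z - w\<close> is the sum of the terms
  \<open>a \<nu> * (z ^ \<nu> - w ^ \<nu>)\<close>. By \<open>norm_power_diff_le\<close> and
  \<open>k \<ge> 1\<close> its norm is at most \<open>r * norm (z - w)\<close> with
  \<open>r < 1\<close>, which forces \<open>z = w\<close>.\<close>

lemma coeff_sum_le_1_imp_univalent:
  assumes f: "has_neg_series f k a" and k: "k \<ge> 1"
  defines "q \<equiv> (\<lambda>n. real (n + k + 1) * a (n + k + 1))"
  assumes q: "summable q" "suminf q \<le> 1"
  shows "inj_on f (ball 0 1)"
proof (rule inj_onI)
  fix z w :: complex assume "z \<in> ball 0 1" "w \<in> ball 0 1" and eq: "f z = f w"
  then have z: "norm z < 1" and w: "norm w < 1" by auto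
  define r where "r = max (norm z) (norm w)"
  have r: "norm z \<le> r" "norm w \<le> r" "r < 1" "0 \<le> r"
    using z w by (auto simp: r_def le_max_iff_disj)
  have sums: "(\<lambda>n. of_real (a (n + k + 1)) * v ^ (n + k + 1)) sums (v - f v)" if "norm v < 1" for v
    using f that by (simp add: has_neg_series_def neg_series_def summable_sums)
  have a: "a (n + k + 1) \<ge> 0" for n
    using f by (simp add: has_neg_series_def)
  have le: "norm (of_real (a (n + k + 1)) * (z ^ (n + k + 1) - w ^ (n + k + 1))) \<le>
      q n * (r * norm (z - w))" for n
  proof -
    have "norm (z ^ (n + k + 1) - w ^ (n + k + 1)) \<le> real (n + k + 1) * r ^ (n + k) * norm (z - w)"
      using norm_power_diff_le[OF r(1,2), of "n + k"] by simp
    also have "\<dots> \<le> real (n + k + 1) * r ^ 1 * norm (z - w)"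
      using r k by (intro mult_right_mono mult_left_mono power_decreasing) auto
    finally have "a (n + k + 1) * norm (z ^ (n + k + 1) - w ^ (n + k + 1)) \<le>
        a (n + k + 1) * (real (n + k + 1) * r ^ 1 * norm (z - w))"
      using a by (rule mult_left_mono)
    then show ?thesis
      using a[of n] by (simp only: norm_mult norm_of_real q_def abs_of_nonneg) (simp add: mult_ac)
  qed
  have "(\<lambda>n. of_real (a (n + k + 1)) * (z ^ (n + k + 1) - w ^ (n + k + 1))) sums (z - w)"
    using sums_diff[OF sums[OF z] sums[OF w]] eq by (simp add: right_diff_distrib)
  then have "norm (z - w) = norm (\<Sum>n. of_real (a (n + k + 1)) * (z ^ (n + k + 1) - w ^ (n + k + 1)))"
    by (simp add: sums_iff)
  also have "\<dots> \<le> (\<Sum>n. q n * (r * norm (z - w)))"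
    by (rule norm_suminf_le[OF le summable_mult2[OF q(1)]])
  also have "\<dots> = suminf q * (r * norm (z - w))"
    using q(1) by (simp add: suminf_mult2)
  also have "\<dots> \<le> 1 * (r * norm (z - w))"
    using q(2) r by (intro mult_right_mono) auto
  finally have "(1 - r) * norm (z - w) \<le> 0" by (simp add: algebra_simps)
  with r(3) have "norm (z - w) \<le> 0" by (simp add: mult_le_0_iff)
  then show "z = w" by simp
qed

section \<open>The modified Hadamard product\<close>

lemma term_le_suminf:
  fixes p :: "nat \<Rightarrow> real"
  assumes "summable p" "\<And>n. p n \<ge> 0"
  shows "p n \<le> suminf p"
  using sum_le_suminf[OF assms(1), of "{n}"] assms(2) by simp

theorem theorem9:
  fixes k :: nat and \<tau> \<mu> \<delta> \<gamma> \<xi> :: real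
    and f \<psi> \<Omega> :: "complex \<Rightarrow> complex" and a l :: "nat \<Rightarrow> real"
  assumes "k \<ge> 1"
    and "0 < \<tau>" "\<tau> \<le> 1" "0 < \<mu>" "\<mu> \<le> 1" "0 \<le> \<tau> - \<mu>" "\<tau> - \<mu> < 1"
    and "0 \<le> \<delta>" "\<delta> < 1" "0 \<le> \<gamma>" "\<gamma> < 1" "\<tau> - \<mu> + \<gamma> < 1"
    and "has_neg_series f k a" and "has_neg_series \<psi> k l"
    and "f \<in> class_PT \<tau> \<mu> k \<delta> \<gamma>" and "\<psi> \<in> class_PT \<tau> \<mu> k \<delta> \<gamma>"
    and "\<Omega> = neg_series k (\<lambda>\<nu>. a \<nu> * l \<nu>)"
    and "0 \<le> \<xi>" "\<xi> < 1" "\<tau> - \<mu> + \<xi> < 1"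
    and "\<xi> \<le> 1 - (1 - \<gamma>)\<^sup>2 * pochhammer (\<mu> + 1) k /
                    ((1 + \<delta> * real k) * pochhammer (\<tau> + 1) k)"
  shows "\<Omega> \<in> class_PT \<tau> \<mu> k \<delta> \<xi>"
proof -
  note f = \<open>has_neg_series f k a\<close> and \<psi> = \<open>has_neg_series \<psi> k l\<close>
  \<comment> \<open>Index 0 now stands for \<open>\<nu> = k + 1\<close>, so \<open>W 0\<close> is
    the least weight that occurs, and its reciprocal is the quotient in the bound on
    \<open>\<xi>\<close>.\<close>
  define W where "W = (\<lambda>n. class_weight \<tau> \<mu> \<delta> (n + k))"
  define A where "A = (\<lambda>n. a (n + k + 1))"
  define L where "L = (\<lambda>n. l (n + k + 1))"
  have A: "A n \<ge> 0" and L: "L n \<ge> 0" for n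
    using f \<psi> by (auto simp: A_def L_def has_neg_series_def)
  have Wk: "W 0 > 0"
    using class_weight_pos assms unfolding W_def by blast
  have W: "W 0 \<le> W n" for n
    using monoD[OF class_weight_mono, of \<mu> \<tau> \<delta> k "n + k"] assms unfolding W_def by simp
  have W_nonneg: "W n \<ge> 0" for n
    using W[of n] Wk by simp

  have inj: "inj_on f (ball 0 1)" "inj_on \<psi> (ball 0 1)"
    using assms by (auto simp: class_PT_def class_P_def)
  have qf: "summable (\<lambda>n. real (n + k + 1) * A n)" "(\<Sum>n. real (n + k + 1) * A n) \<le> 1"
    unfolding A_def by (rule univalent_imp_coeff_sum_le_1[OF f \<open>k \<ge> 1\<close> inj(1)])+
  have q\<psi>: "summable (\<lambda>n. real (n + k + 1) * L n)" "(\<Sum>n. real (n + k + 1) * L n) \<le> 1"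
    unfolding L_def by (rule univalent_imp_coeff_sum_le_1[OF \<psi> \<open>k \<ge> 1\<close> inj(2)])+
  have A1: "A n \<le> 1" for n
  proof -
    have "A n \<le> real (n + k + 1) * A n"
      using mult_right_mono[of 1 "real (n + k + 1)" "A n"] A[of n] by simp
    also have "\<dots> \<le> 1"
      using term_le_suminf[OF qf(1), of n] qf(2) A by simp
    finally show ?thesis .
  qed
  have q_le: "real (n + k + 1) * (A n * L n) \<le> real (n + k + 1) * L n" for n
    using A1[of n] A[of n] L[of n] by (intro mult_left_mono mult_left_le_one_le) auto
  have q\<Omega>: "summable (\<lambda>n. real (n + k + 1) * (A n * L n))"
    by (rule summable_comparison_test'[OF q\<psi>(1), of 0]) (use q_le A L in auto)
  have "(\<Sum>n. real (n + k + 1) * (A n * L n)) \<le> (\<Sum>n. real (n + k + 1) * L n)"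
    by (rule suminf_le[OF q_le q\<Omega> q\<psi>(1)])
  with q\<psi>(2) have q\<Omega>_le: "(\<Sum>n. real (n + k + 1) * (A n * L n)) \<le> 1" by simp

  have pf: "summable (\<lambda>n. W n * A n)" "(\<Sum>n. W n * A n) \<le> 1 - \<gamma>"
    and p\<psi>: "summable (\<lambda>n. W n * L n)" "(\<Sum>n. W n * L n) \<le> 1 - \<gamma>"
    using Re_mem_class_iff[OF f, of \<tau> \<mu> \<delta> \<gamma>] Re_mem_class_iff[OF \<psi>, of \<tau> \<mu> \<delta> \<gamma>] assms
    by (auto simp: class_PT_def W_def A_def L_def)
  have p_le: "W n * (A n * L n) \<le> (1 - \<gamma>) / W 0 * (W n * L n)" for n
  proof -
    have "W n * A n \<le> 1 - \<gamma>"
      using term_le_suminf[OF pf(1), of n] pf(2) A W_nonneg by simp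
    then have "W n * A n * L n \<le> (1 - \<gamma>) * L n"
      using L by (rule mult_right_mono)
    \<comment> \<open>Inserting \<open>W 0\<close> allows it to be enlarged to \<open>W n\<close>,
      which produces a term of the convergent series for \<open>\<psi>\<close>.\<close>
    also have "\<dots> = (1 - \<gamma>) / W 0 * (W 0 * L n)"
      using Wk by simp
    also have "\<dots> \<le> (1 - \<gamma>) / W 0 * (W n * L n)"
      using W L Wk \<open>\<gamma> < 1\<close> by (intro mult_left_mono mult_right_mono) auto
    finally show ?thesis by (simp add: mult.assoc)
  qed
  have p\<Omega>: "summable (\<lambda>n. W n * (A n * L n))"
    by (rule summable_comparison_test'[OF summable_mult[OF p\<psi>(1), of "(1 - \<gamma>) / W 0"], of 0])
       (use p_le A L W_nonneg in auto)
  have "(\<Sum>n. W n * (A n * L n)) \<le> (1 - \<gamma>) / W 0 * (\<Sum>n. W n * L n)"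
    using suminf_le[OF p_le p\<Omega> summable_mult[OF p\<psi>(1)]] by (simp only: suminf_mult[OF p\<psi>(1)])
  also have "\<dots> \<le> (1 - \<gamma>) / W 0 * (1 - \<gamma>)"
    using p\<psi>(2) Wk \<open>\<gamma> < 1\<close> by (intro mult_left_mono) auto
  also have "\<dots> = (1 - \<gamma>)\<^sup>2 * pochhammer (\<mu> + 1) k / ((1 + \<delta> * real k) * pochhammer (\<tau> + 1) k)"
    by (simp add: W_def class_weight_def power2_eq_square)
  also have "\<dots> \<le> 1 - \<xi>" using assms by simp
  finally have p\<Omega>_le: "(\<Sum>n. W n * (A n * L n)) \<le> 1 - \<xi>" .

  have \<Omega>: "has_neg_series \<Omega> k (\<lambda>\<nu>. a \<nu> * l \<nu>)"
    unfolding has_neg_series_def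
  proof (intro conjI ballI allI impI)
    fix z :: complex assume "z \<in> ball 0 1"
    then have z: "norm z < 1" by simp
    show "summable (\<lambda>n. of_real (a (n + k + 1) * l (n + k + 1)) * z ^ (n + k + 1))"
    proof (rule summable_comparison_test'[OF q\<Omega>, of 0])
      fix n
      \<comment> \<open>Convergence on the disc follows from the summable majorant
        \<open>q\<Omega>\<close>, as the power of \<open>norm z\<close> is at most 1 and hence at
        most \<open>n + k + 1\<close>.\<close>
      have "norm z ^ (n + k + 1) \<le> 1 ^ (n + k + 1)"
        using z by (intro power_mono) auto
      then have "norm z ^ (n + k + 1) \<le> real (n + k + 1)" by simp
      then have "norm z ^ (n + k + 1) * (A n * L n) \<le> real (n + k + 1) * (A n * L n)"
        using A L by (intro mult_right_mono) auto
      then show "norm (of_real (a (n + k + 1) * l (n + k + 1)) * z ^ (n + k + 1)) \<le>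
          real (n + k + 1) * (A n * L n)"
        using A[of n] L[of n]
        by (simp only: norm_mult norm_of_real norm_power A_def L_def abs_of_nonneg mult_nonneg_nonneg)
           (simp only: mult_ac)
    qed
  qed (use f \<psi> assms(17) in \<open>auto simp: has_neg_series_def\<close>)
  have "\<Omega> holomorphic_on ball 0 1"
    using neg_coeffs_sums[OF \<Omega> \<open>k \<ge> 1\<close>] by (rule power_series_holomorphic_on_disc)
  moreover have "inj_on \<Omega> (ball 0 1)"
    using coeff_sum_le_1_imp_univalent[OF \<Omega> \<open>k \<ge> 1\<close>] q\<Omega> q\<Omega>_le by (simp add: A_def L_def)
  moreover have "\<forall>z\<in>ball 0 1. Re (remove_sings (class_expr \<tau> \<mu> \<delta> \<Omega>) z) > \<xi>"
    using Re_mem_class_iff[OF \<Omega>, of \<tau> \<mu> \<delta> \<xi>] assms p\<Omega> p\<Omega>_le by (simp add: W_def A_def L_def)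
  ultimately show ?thesis
    using \<Omega> by (auto simp: class_PT_def class_P_def)
qed

end
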